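(* Let $G$ be a group and let $S$ be a nontrivial malnormal subgroup of $G$. Then either $\mathrm{ncl}_{G}(S) = G$ or $\mathrm{ncl}_{G}(S)$ is a proper essential subgroup of $G$.
   Context: A subgroup $S$ of $G$ is malnormal if $gSg^{-1} \cap S = \{1\}$ for every $g \in G \setminus S$. $\mathrm{ncl}_{G}(S)$ denotes the normal closure of $S$ in $G$, i.e. the smallest normal subgroup of $G$ containing $S$. A normal subgroup $E$ of a group $G$ is called an essential subgroup of $G$ if every nontrivial normal subgroup of $G$ intersects $E$ nontrivially; it is a proper essential subgroup if moreover $E \neq G$. *)

theory Defs
  imports "HOL-Algebra.Algebra"
begin

definition malnormal :: "'a set \<Rightarrow> ('a, 'b) monoid_scheme \<Rightarrow> bool" where
  "malnormal S G \<longleftrightarrow> subgroup S G \<and>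
     (\<forall>g \<in> carrier G - S. (g <#\<^bsub>G\<^esub> S #>\<^bsub>G\<^esub> inv\<^bsub>G\<^esub> g) \<inter> S = {\<one>\<^bsub>G\<^esub>})"

text \<open>
  Meaningful when \<open>G\<close> is a group and \<open>S \<subseteq> carrier G\<close>; the two lemmas below show that in
  this case it is the smallest normal subgroup containing \<open>S\<close>.
\<close>
definition normal_closure :: "('a, 'b) monoid_scheme \<Rightarrow> 'a set \<Rightarrow> 'a set" where
  "normal_closure G S = \<Inter>{N. N \<lhd> G \<and> S \<subseteq> N}"

lemma (in group) carrier_normal: "carrier G \<lhd> G"
  by (simp add: normal_inv_iff subgroup_self)

lemma (in group) normal_closure_normal:
  assumes "S \<subseteq> carrier G"
  shows "normal_closure G S \<lhd> G" and "S \<subseteq> normal_closure G S"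
proof -
  have "subgroup (normal_closure G S) G"
    unfolding normal_closure_def
  proof (rule subgroups_Inter)
    show "{N. N \<lhd> G \<and> S \<subseteq> N} \<noteq> {}"
      using carrier_normal assms by blast
  qed (simp add: normal_imp_subgroup)
  then show "normal_closure G S \<lhd> G"
    unfolding normal_inv_iff by (auto simp: normal_closure_def normal_inv_iff)
  show "S \<subseteq> normal_closure G S"
    by (auto simp: normal_closure_def)
qed

lemma normal_closure_least:
  assumes "N \<lhd> G" and "S \<subseteq> N"
  shows "normal_closure G S \<subseteq> N"
  using assms by (auto simp: normal_closure_def)

definition essential_subgroup :: "'a set \<Rightarrow> ('a, 'b) monoid_scheme \<Rightarrow> bool" where
  "essential_subgroup E G \<longleftrightarrow> E \<lhd> G \<and>
     (\<forall>N. N \<lhd> G \<and> N \<noteq> {\<one>\<^bsub>G\<^esub>} \<longrightarrow> N \<inter> E \<noteq> {\<one>\<^bsub>G\<^esub>})"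

definition proper_essential_subgroup :: "'a set \<Rightarrow> ('a, 'b) monoid_scheme \<Rightarrow> bool" where
  "proper_essential_subgroup E G \<longleftrightarrow> essential_subgroup E G \<and> E \<noteq> carrier G"

end

theory Submission
  imports Defs
begin

text \<open>
  Normal subgroups with trivial intersection commute. So a normal subgroup \<open>N\<close> meeting the normal
  closure \<open>E\<close> of \<open>S\<close> trivially centralizes \<open>S\<close>. Malnormality puts the centralizer of any nontrivial
  element of \<open>S\<close> inside \<open>S\<close>, hence \<open>N \<subseteq> S \<subseteq> E\<close>, and \<open>N\<close> is trivial.
\<close>

text \<open>The commutator of \<open>x\<close> and \<open>y\<close> is a conjugate of
  \<open>y\<close> times \<open>inv y\<close>, hence in \<open>N\<close>, and \<open>x\<close> times
  a conjugate of \<open>inv x\<close>, hence in \<open>M\<close>; so it is trivial.\<close>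

lemma (in group) normal_trivial_inter_commute:
  assumes "M \<lhd> G" and "N \<lhd> G" and "M \<inter> N = {\<one>}" and "x \<in> M" and "y \<in> N"
  shows "x \<otimes> y = y \<otimes> x"
proof -
  interpret M: normal M G by fact
  interpret N: normal N G by fact
  have x: "x \<in> carrier G" and y: "y \<in> carrier G"
    using assms(4,5) by auto
  have "x \<otimes> y \<otimes> inv x \<otimes> inv y \<in> N"
    using assms(5) x by (simp add: N.inv_op_closed2)
  moreover have "x \<otimes> (y \<otimes> inv x \<otimes> inv y) \<in> M"
    using assms(4) y by (simp add: M.inv_op_closed2)
  moreover have "x \<otimes> (y \<otimes> inv x \<otimes> inv y) = x \<otimes> y \<otimes> inv x \<otimes> inv y"
    using x y by (simp add: m_assoc)
  ultimately have "x \<otimes> y \<otimes> inv x \<otimes> inv y = \<one>"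
    using assms(3) by auto
  then have "x \<otimes> y \<otimes> inv (y \<otimes> x) = \<one>"
    using x y by (simp add: m_assoc inv_mult_group)
  \<comment> \<open>\<open>inv_equality\<close> makes \<open>x \<otimes> y\<close> the inverse of
    \<open>inv (y \<otimes> x)\<close>; the double inverse cancels.\<close>
  then show ?thesis
    using x y inv_equality[of "x \<otimes> y" "inv (y \<otimes> x)"] by simp
qed

text \<open>Conjugation by \<open>g\<close> fixes \<open>s\<close>, so \<open>s\<close> is a
  nontrivial common element of \<open>S\<close> and its conjugate by \<open>g\<close>, which
  malnormality forbids for \<open>g\<close> outside \<open>S\<close>.\<close>

lemma (in group) malnormal_centralizer:
  assumes "malnormal S G" and "s \<in> S" and "s \<noteq> \<one>"
    and "g \<in> carrier G" and "g \<otimes> s = s \<otimes> g"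
  shows "g \<in> S"
proof (rule ccontr)
  assume "g \<notin> S"
  then have trivial: "(g <# S #> inv g) \<inter> S = {\<one>}"
    using assms(1,4) unfolding malnormal_def by blast
  have "subgroup S G"
    using assms(1) unfolding malnormal_def by blast
  then have "s \<in> carrier G"
    using assms(2) by (rule subgroup.mem_carrier)
  then have "g \<otimes> s \<otimes> inv g = s"
    unfolding assms(5) using assms(4) by (simp add: m_assoc)
  then have "s \<in> g <# S #> inv g"
    using assms(2) unfolding l_coset_def r_coset_def by fastforce
  with trivial assms(2,3) show False
    by blast
qed

theorem corollary2p6:
  fixes G :: "('a, 'b) monoid_scheme" and S :: "'a set"
  assumes "group G"
    and "malnormal S G"
    and "S \<noteq> {\<one>\<^bsub>G\<^esub>}"
  shows "normal_closure G S = carrier G \<or> proper_essential_subgroup (normal_closure G S) G"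
proof -
  interpret group G by fact
  let ?E = "normal_closure G S"
  have S: "subgroup S G"
    using assms(2) unfolding malnormal_def by blast
  then obtain s where s: "s \<in> S" "s \<noteq> \<one>\<^bsub>G\<^esub>"
    using assms(3) subgroup.one_closed by blast
  have E: "?E \<lhd> G" "S \<subseteq> ?E"
    using normal_closure_normal subgroup.subset[OF S] by blast+
  have "N = {\<one>\<^bsub>G\<^esub>}" if N: "N \<lhd> G" and trivial: "N \<inter> ?E = {\<one>\<^bsub>G\<^esub>}" for N
  proof -
    have "n \<in> S" if n: "n \<in> N" for n
    proof (rule malnormal_centralizer[OF assms(2) s])
      show "n \<in> carrier G"
        using n by (rule subgroup.mem_carrier[OF normal_imp_subgroup[OF N]])
      show "n \<otimes>\<^bsub>G\<^esub> s = s \<otimes>\<^bsub>G\<^esub> n"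
        using normal_trivial_inter_commute[OF N E(1) trivial n] s(1) E(2) by blast
    qed
    with E(2) trivial show ?thesis
      by blast
  qed
  \<comment> \<open>\<open>?E\<close> is essential in either case; the disjunction only asks whether
    it is the whole group.\<close>
  then show ?thesis
    using E(1) unfolding proper_essential_subgroup_def essential_subgroup_def by blast
qed

end
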